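(* Let $G$ be a locally convex geometric graph with $n=|V(G)|$ vertices and $e=|E(G)|$ edges such that $2e\ge n$, and let $d(G)=2e/n$ be its average degree. Then the number $|DJ(G)|$ of unordered pairs of disjoint edges of $G$ satisfies \[ |DJ(G)|\ge \frac{n}{2}\binom{d(G)}{3}, \] where for a real number $x$, $\binom{x}{3}=\frac{x(x-1)(x-2)}{6}$.
   Context: A geometric graph is a graph drawn in the plane whose vertex set is a finite set of points in general position (no three collinear) and whose edges are straight line segments joining pairs of these points. Two edges are disjoint if the corresponding closed segments have no common point. $DJ(G)$ is the set of unordered pairs of disjoint edges of $G$. The neighborhood $N(v)$ of a vertex $v$ is the set of vertices adjacent to $v$. A vertex $v$ is convex if it lies outside the convex hull of $N(v)$; a geometric graph is locally convex if all its vertices are convex. *)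

theory Defs
  imports "HOL-Analysis.Analysis"
begin

locale geometric_graph =
  fixes V :: "(real ^ 2) set" and E :: "(real ^ 2) set set"
  assumes finite_vertices: "finite V"
    and general_position:
      "\<And>a b c. \<lbrakk>a \<in> V; b \<in> V; c \<in> V; a \<noteq> b; a \<noteq> c; b \<noteq> c\<rbrakk> \<Longrightarrow> \<not> collinear {a, b, c}"
    and edges: "\<And>e. e \<in> E \<Longrightarrow> \<exists>u\<in>V. \<exists>v\<in>V. u \<noteq> v \<and> e = {u, v}"

text \<open>An edge is a two-element set of points; its convex hull is the closed segment joining them.\<close>

definition edge_segment :: "(real ^ 2) set \<Rightarrow> (real ^ 2) set" where
  "edge_segment e = convex hull e"

lemma edge_segment_pair: "edge_segment {u, v} = closed_segment u v"
  by (simp add: edge_segment_def segment_convex_hull)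

definition disjoint_edge_pairs :: "(real ^ 2) set set \<Rightarrow> (real ^ 2) set set set" where
  "disjoint_edge_pairs E =
     {{e, f} | e f. e \<in> E \<and> f \<in> E \<and> e \<noteq> f \<and> edge_segment e \<inter> edge_segment f = {}}"

definition neighborhood :: "(real ^ 2) set set \<Rightarrow> real ^ 2 \<Rightarrow> (real ^ 2) set" where
  "neighborhood E v = {u. u \<noteq> v \<and> {u, v} \<in> E}"

definition convex_vertex :: "(real ^ 2) set set \<Rightarrow> real ^ 2 \<Rightarrow> bool" where
  "convex_vertex E v \<longleftrightarrow> v \<notin> convex hull (neighborhood E v)"

definition locally_convex :: "(real ^ 2) set \<Rightarrow> (real ^ 2) set set \<Rightarrow> bool" where
  "locally_convex V E \<longleftrightarrow> (\<forall>v\<in>V. convex_vertex E v)"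

definition average_degree :: "(real ^ 2) set \<Rightarrow> (real ^ 2) set set \<Rightarrow> real" where
  "average_degree V E = 2 * real (card E) / real (card V)"

lemma gchoose_3: "(x :: real) gchoose 3 = x * (x - 1) * (x - 2) / 6"
  by (simp add: gbinomial_prod_rev numeral_3_eq_3 fact_numeral algebra_simps)

end

theory Submission
  imports Defs
begin

text \<open>
  Count paths \<open>x - u - v - y\<close> in which \<open>x\<close> lies to the left and \<open>y\<close> to the right of the directed
  line \<open>uv\<close>. The edges \<open>ux\<close> and \<open>vy\<close> of such a path are disjoint, and an ordered pair of disjoint
  edges comes from at most one such path. If \<open>a(u,v)\<close> is the number of neighbors of \<open>u\<close> to the left
  of \<open>uv\<close>, the number of paths is the sum of \<open>a(u,v) a(v,u)\<close> over all directed edges. Since \<open>u\<close> is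
  convex, the directions to its neighbors are linearly ordered, so \<open>a(u,v)\<close> takes each value at most
  once as \<open>v\<close> varies. Hence, for every natural number \<open>D\<close>, linearizing the product by
  \<open>ab \<ge> C(D,2) - C(D-a,2) - C(D-b,2)\<close> and summing gives at least \<open>2e C(D,2) - 2n C(D+1,3)\<close> paths.
  For \<open>D = \<lfloor>d\<rfloor>\<close> this is \<open>n\<close> times the linear interpolation of \<open>C(x,3)\<close> between consecutive integers,
  which dominates \<open>C(d,3)\<close> because that polynomial is convex for \<open>x \<ge> 1\<close>.
\<close>

section \<open>Symmetric pair counting and binomial inequalities\<close>

lemma card_symmetric_pairs:
  assumes "finite S" and sym: "\<And>x y. (x, y) \<in> S \<Longrightarrow> (y, x) \<in> S"
    and irrefl: "\<And>x. (x, x) \<notin> S"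
  shows "card S = 2 * card ((\<lambda>(x, y). {x, y}) ` S)"
proof -
  let ?f = "\<lambda>(x, y). {x, y}"
  let ?fib = "\<lambda>p. {q \<in> S. ?f q = p}"
  have two: "card (?fib p) = 2" if "p \<in> ?f ` S" for p
  proof -
    from that obtain x y where xy: "(x, y) \<in> S" "p = {x, y}"
      by auto
    then have "?fib p = {(x, y), (y, x)}"
      using sym by (auto simp: doubleton_eq_iff)
    moreover have "x \<noteq> y"
      using xy irrefl by auto
    ultimately show ?thesis
      by simp
  qed
  have "card S = (\<Sum>p\<in>?f ` S. card (?fib p))"
    using sum.image_gen[OF \<open>finite S\<close>, of "\<lambda>_. 1::nat" ?f] by simp
  also have "\<dots> = 2 * card (?f ` S)"
    using two by simp
  finally show ?thesis .
qed

text \<open>For \<open>a\<close>, \<open>b\<close> at most \<open>D\<close>, twice the gap between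
  the two sides is \<open>r * (r - 1)\<close> with \<open>r = D - a - b\<close>, a product of
  consecutive integers and so nonnegative.\<close>

lemma choose_two_product_bound:
  fixes a b D :: nat
  shows "D choose 2 \<le> a * b + ((D - a) choose 2) + ((D - b) choose 2)"
proof -
  \<comment> \<open>Capping at \<open>D\<close> turns the truncated differences
    \<open>D - a\<close>, \<open>D - b\<close> into integer ones and can only shrink the
    product.\<close>
  define p q where "p = int (min a D)" and "q = int (min b D)"
  have tw: "2 * int (n choose 2) = int n * (int n - 1)" for n
  proof -
    have "2 * (n choose 2) = n * (n - 1)"
      unfolding choose_two by (rule dvd_mult_div_cancel) auto
    then have "2 * int (n choose 2) = int (n * (n - 1))"
      by (metis of_nat_mult of_nat_numeral)
    then show ?thesis
      by (cases n) (auto simp: algebra_simps)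
  qed
  define r where "r = int D - p - q"
  have "0 \<le> r * (r - 1)"
    by (cases "r \<le> 0") (auto intro: mult_nonpos_nonpos)
  then have "int D * (int D - 1) \<le> 2 * (p * q) + (int D - p) * (int D - p - 1) + (int D - q) * (int D - q - 1)"
    unfolding r_def by (simp add: algebra_simps)
  moreover have "int (D - a) = int D - p" "int (D - b) = int D - q"
    by (auto simp: p_def q_def min_def)
  moreover have "p * q \<le> int a * int b"
    unfolding p_def q_def by (intro mult_mono) auto
  ultimately have "2 * int (D choose 2) \<le> 2 * (int a * int b) + 2 * int ((D - a) choose 2) + 2 * int ((D - b) choose 2)"
    unfolding tw by simp
  then show ?thesis
    by (metis (no_types, opaque_lifting) distrib_left mult_le_cancel_left_pos of_nat_add of_nat_le_iff
        of_nat_mult zero_less_numeral)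
qed

lemma sum_choose_two_descending: "(\<Sum>i<D. (D - i) choose 2) = Suc D choose 3"
proof -
  have "(\<Sum>i<D. (D - i) choose 2) = (\<Sum>i<D. Suc i choose 2)"
    using sum.nat_diff_reindex[of "\<lambda>i. Suc i choose 2" D] by (simp add: Suc_diff_Suc)
  also have "\<dots> = Suc D choose 3"
    by (induction D) (auto simp: numeral_eq_Suc)
  finally show ?thesis .
qed

text \<open>The right side is the chord of \<open>x gchoose 3\<close> through \<open>D\<close> and
  \<open>D + 1\<close>. With \<open>t = x - D\<close>, six times the gap is
  \<open>t * (1 - t) * (t + 3 * D - 2)\<close>.\<close>

lemma gbinomial_3_le_interpolation:
  fixes x D :: real
  assumes "1 \<le> D" "D \<le> x" "x \<le> D + 1"
  shows "x gchoose 3 \<le> x * (D gchoose 2) - 2 * ((D + 1) gchoose 3)"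
proof -
  define t where "t = x - D"
  have "0 \<le> t * (1 - t) * (t + 3 * D - 2)"
    using assms by (intro mult_nonneg_nonneg) (auto simp: t_def)
  moreover have "D gchoose 2 = D * (D - 1) / 2"
    by (simp add: gbinomial_prod_rev numeral_2_eq_2 algebra_simps)
  ultimately show ?thesis
    by (simp only: gchoose_3 t_def) (simp add: field_simps)
qed

section \<open>Orientation of point triples in the plane\<close>

text \<open>Twice the signed area of the triangle \<open>u v w\<close>: positive iff
  \<open>w\<close> lies to the left of the directed line from \<open>u\<close> to
  \<open>v\<close>.\<close>

definition orient :: "real ^ 2 \<Rightarrow> real ^ 2 \<Rightarrow> real ^ 2 \<Rightarrow> real" where
  "orient u v w = (v $ 1 - u $ 1) * (w $ 2 - u $ 2) - (v $ 2 - u $ 2) * (w $ 1 - u $ 1)"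

lemma orient_degenerate [simp]: "orient u v u = 0" "orient u v v = 0" "orient u u v = 0"
  by (simp_all add: orient_def)

lemma orient_swap: "orient v u w = - orient u v w"
  by (simp add: orient_def algebra_simps)

lemma orient_swap_last: "orient u w v = - orient u v w"
  by (simp add: orient_def algebra_simps)

lemma orient_convex_combination:
  "orient u v ((1 - t) *\<^sub>R x + t *\<^sub>R y) = (1 - t) * orient u v x + t * orient u v y"
  by (simp add: orient_def algebra_simps)

lemma collinear_if_orient_zero:
  assumes "orient u v w = 0"
  shows "collinear {v, u, w}"
proof (cases "v = u")
  case False
  have eq: "(v $ 1 - u $ 1) * (w $ 2 - u $ 2) = (v $ 2 - u $ 2) * (w $ 1 - u $ 1)"
    using assms by (simp add: orient_def)
  have "\<exists>c. w - u = c *\<^sub>R (v - u)"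
  proof (cases "v $ 1 = u $ 1")
    case True
    then have "v $ 2 \<noteq> u $ 2"
      using False by (auto simp: vec_eq_iff forall_2)
    with True eq show ?thesis
      by (intro exI[of _ "(w $ 2 - u $ 2) / (v $ 2 - u $ 2)"]) (auto simp: vec_eq_iff forall_2)
  next
    case False
    then have "w $ 2 - u $ 2 = (w $ 1 - u $ 1) / (v $ 1 - u $ 1) * (v $ 2 - u $ 2)"
      using eq by (simp add: eq_divide_eq mult.commute)
    with False show ?thesis
      by (intro exI[of _ "(w $ 1 - u $ 1) / (v $ 1 - u $ 1)"]) (simp add: vec_eq_iff forall_2)
  qed
  then show ?thesis
    by (auto simp: collinear_3[of v u w] collinear_lemma)
qed auto

text \<open>The first three hypotheses put all directions from \<open>u\<close> into one open
  half-plane, which prevents left turns from closing up cyclically. The identity in the proof is the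
  linear dependence of three plane vectors, paired with \<open>c\<close>.\<close>

lemma orient_trans:
  assumes "0 < c \<bullet> (v - u)" "0 < c \<bullet> (w - u)" "0 < c \<bullet> (z - u)"
    and "0 < orient u v w" "0 < orient u w z"
  shows "0 < orient u v z"
proof -
  have "orient u v z * (c \<bullet> (w - u)) = orient u v w * (c \<bullet> (z - u)) + orient u w z * (c \<bullet> (v - u))"
    by (simp add: orient_def inner_vec_def sum_2 algebra_simps)
  then have "0 < orient u v z * (c \<bullet> (w - u))"
    using assms by (simp add: add_pos_pos)
  then show ?thesis
    using assms(2) by (simp add: zero_less_mult_iff)
qed

lemma disjoint_segments_of_opposite_sides:
  assumes "0 < orient u v x" "orient u v y < 0"
  shows "closed_segment u x \<inter> closed_segment v y = {}"
proof (rule ccontr)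
  assume "closed_segment u x \<inter> closed_segment v y \<noteq> {}"
  then obtain s t where st: "0 \<le> s" "0 \<le> t"
    and eq: "(1 - s) *\<^sub>R u + s *\<^sub>R x = (1 - t) *\<^sub>R v + t *\<^sub>R y"
    by (fastforce simp: in_segment)
  from arg_cong[OF eq, of "orient u v"] have o: "s * orient u v x = t * orient u v y"
    unfolding orient_convex_combination by simp
  \<comment> \<open>A common point would lie weakly on both sides of the line \<open>uv\<close>,
    hence on it, so it would be both \<open>u\<close> and \<open>v\<close>.\<close>
  have "0 \<le> s * orient u v x" "t * orient u v y \<le> 0"
    using assms st by (auto intro: mult_nonneg_nonpos)
  with o assms have "s = 0" "t = 0"
    by auto
  with eq have "u = v"
    by simp
  with assms show False
    by simp
qed

lemma opposite_side_path_unique: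
  assumes "{u, x} = {u', x'}" "{v, y} = {v', y'}"
    and "0 < orient u v x" "0 < orient v u y" "0 < orient u' v' x'" "0 < orient v' u' y'"
  shows "u = u' \<and> v = v' \<and> x = x' \<and> y = y'"
  using assms unfolding doubleton_eq_iff orient_def
  \<comment> \<open>In the three cases with swapped ends the sign conditions contradict each other: two fix opposite
    signs for the same triangle, or all four signs violate
    \<open>orient q r s - orient p r s + orient p q s - orient p q r = 0\<close>.\<close>
  by (elim disjE conjE) (simp_all add: algebra_simps)

section \<open>Directed edges, left neighbors and disjoint pairs\<close>

definition left_neighbors :: "(real ^ 2) set set \<Rightarrow> real ^ 2 \<Rightarrow> real ^ 2 \<Rightarrow> (real ^ 2) set" where
  "left_neighbors E u v = {w \<in> neighborhood E u. 0 < orient u v w}"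

definition darts :: "(real ^ 2) set set \<Rightarrow> ((real ^ 2) \<times> (real ^ 2)) set" where
  "darts E = {(u, v). v \<in> neighborhood E u}"

text \<open>Ordered pairs keep the map from paths injective: a path and its reversal are counted at
  the darts \<open>(u, v)\<close> and \<open>(v, u)\<close> and give the same two edges in opposite
  order.\<close>

definition disjoint_ordered_pairs where
  "disjoint_ordered_pairs E =
     {(e, f). e \<in> E \<and> f \<in> E \<and> e \<noteq> f \<and> edge_segment e \<inter> edge_segment f = {}}"

context geometric_graph
begin

lemma finite_edges: "finite E"
proof (rule finite_subset)
  show "E \<subseteq> Pow V"
    using edges by fastforce
qed (simp add: finite_vertices)

lemma neighborhood_subset: "neighborhood E u \<subseteq> V"
proof
  fix v assume "v \<in> neighborhood E u"
  then have "{v, u} \<in> E"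
    by (simp add: neighborhood_def)
  then show "v \<in> V"
    using edges by (fastforce simp: doubleton_eq_iff)
qed

lemma neighborhood_sym: "v \<in> neighborhood E u \<longleftrightarrow> u \<in> neighborhood E v"
  by (auto simp: neighborhood_def insert_commute)

lemma finite_neighborhood: "finite (neighborhood E u)"
  using neighborhood_subset finite_vertices finite_subset by blast

lemma finite_left_neighbors: "finite (left_neighbors E u v)"
  using finite_neighborhood by (simp add: left_neighbors_def)

lemma darts_Sigma: "darts E = (SIGMA u:V. neighborhood E u)"
  using neighborhood_subset neighborhood_sym by (fastforce simp: darts_def)

lemma finite_darts: "finite (darts E)"
  by (simp add: darts_Sigma finite_vertices finite_neighborhood)

lemma card_darts: "card (darts E) = 2 * card E"
proof -
  have "(\<lambda>(x, y). {x, y}) ` darts E = E"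
  proof (intro equalityI subsetI)
    fix e assume "e \<in> E"
    then obtain u v where "u \<noteq> v" "e = {u, v}"
      using edges by blast
    with \<open>e \<in> E\<close> show "e \<in> (\<lambda>(x, y). {x, y}) ` darts E"
      by (intro image_eqI[of _ _ "(v, u)"]) (auto simp: darts_def neighborhood_def insert_commute)
  qed (auto simp: darts_def neighborhood_def insert_commute)
  moreover have "card (darts E) = 2 * card ((\<lambda>(x, y). {x, y}) ` darts E)"
    by (rule card_symmetric_pairs[OF finite_darts])
      (auto simp: darts_def neighborhood_def insert_commute)
  ultimately show ?thesis
    by simp
qed

lemma finite_disjoint_ordered_pairs: "finite (disjoint_ordered_pairs E)"
  by (rule finite_subset[of _ "E \<times> E"]) (auto simp: disjoint_ordered_pairs_def finite_edges)

lemma card_disjoint_ordered_pairs: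
  "card (disjoint_ordered_pairs E) = 2 * card (disjoint_edge_pairs E)"
proof -
  have "disjoint_edge_pairs E = (\<lambda>(x, y). {x, y}) ` disjoint_ordered_pairs E"
    by (auto simp: disjoint_edge_pairs_def disjoint_ordered_pairs_def)
  moreover have "card (disjoint_ordered_pairs E) = 2 * card ((\<lambda>(x, y). {x, y}) ` disjoint_ordered_pairs E)"
    by (rule card_symmetric_pairs[OF finite_disjoint_ordered_pairs])
      (auto simp: disjoint_ordered_pairs_def)
  ultimately show ?thesis
    by simp
qed

lemma sum_left_neighbors_le_disjoint_pairs:
  "(\<Sum>(u, v)\<in>darts E. card (left_neighbors E u v) * card (left_neighbors E v u))
     \<le> 2 * card (disjoint_edge_pairs E)"
proof -
  \<comment> \<open>\<open>T\<close> consists of the paths \<open>x - u - v - y\<close>, and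
    \<open>g\<close> returns their end edges. Right of \<open>uv\<close> is expressed as left of
    \<open>vu\<close>.\<close>
  define T where "T = (SIGMA (u, v):darts E. left_neighbors E u v \<times> left_neighbors E v u)"
  define g where "g = (\<lambda>((u :: real ^ 2, v :: real ^ 2), (x, y)). ({u, x}, {v, y}))"
  have "inj_on g T"
    unfolding inj_on_def T_def g_def left_neighbors_def
    by clarsimp (metis opposite_side_path_unique)
  moreover have "g ((u, v), x, y) \<in> disjoint_ordered_pairs E" if "((u, v), x, y) \<in> T" for u v x y
  proof -
    from that have *: "x \<in> neighborhood E u" "y \<in> neighborhood E v" "0 < orient u v x" "0 < orient v u y"
      by (auto simp: T_def left_neighbors_def)
    then have "closed_segment u x \<inter> closed_segment v y = {}"
      by (intro disjoint_segments_of_opposite_sides) (auto simp: orient_swap[of u v])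
    then have "edge_segment {u, x} \<inter> edge_segment {v, y} = {}" "{u, x} \<noteq> {v, y}"
      by (auto simp: edge_segment_pair doubleton_eq_iff)
    with * show ?thesis
      by (auto simp: g_def disjoint_ordered_pairs_def neighborhood_def insert_commute)
  qed
  then have "g ` T \<subseteq> disjoint_ordered_pairs E"
    by auto
  ultimately have "card T \<le> card (disjoint_ordered_pairs E)"
    using card_inj_on_le finite_disjoint_ordered_pairs by blast
  moreover have "card T = (\<Sum>(u, v)\<in>darts E. card (left_neighbors E u v) * card (left_neighbors E v u))"
    unfolding T_def using finite_darts finite_left_neighbors
    by (subst card_SigmaI) (auto simp: case_prod_unfold card_cartesian_product)
  ultimately show ?thesis
    by (simp add: card_disjoint_ordered_pairs)
qed

text \<open>Strict separation of \<open>u\<close> from the hull of its neighbors provides the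
  half-plane for \<open>orient_trans\<close>. With general position, left turns then order the
  neighbors linearly, and the cardinality is the rank in this order.\<close>

lemma inj_on_card_left_neighbors:
  assumes "u \<in> V" "convex_vertex E u"
  shows "inj_on (\<lambda>v. card (left_neighbors E u v)) (neighborhood E u)"
proof -
  have "closed (convex hull neighborhood E u)"
    using finite_neighborhood finite_imp_compact compact_convex_hull compact_imp_closed by blast
  then obtain c b where "c \<bullet> u < b" "\<forall>x\<in>convex hull neighborhood E u. b < c \<bullet> x"
    using separating_hyperplane_closed_point[of "convex hull neighborhood E u" u] assms(2)
    by (auto simp: convex_vertex_def)
  then have c: "0 < c \<bullet> (v - u)" if "v \<in> neighborhood E u" for v
    using hull_inc[OF that, of convex] by (fastforce simp: inner_diff_right)
  have less: "card (left_neighbors E u w) < card (left_neighbors E u v)"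
    if "v \<in> neighborhood E u" "w \<in> neighborhood E u" "0 < orient u v w" for v w
  proof (rule psubset_card_mono[OF finite_left_neighbors])
    have "left_neighbors E u w \<subseteq> left_neighbors E u v"
      using that orient_trans[of c v u w] c by (auto simp: left_neighbors_def)
    \<comment> \<open>The inclusion is strict because \<open>w\<close> is not to the left of its own
      line \<open>uw\<close>.\<close>
    moreover have "w \<in> left_neighbors E u v - left_neighbors E u w"
      using that by (simp add: left_neighbors_def)
    ultimately show "left_neighbors E u w \<subset> left_neighbors E u v"
      by blast
  qed
  show ?thesis
  proof (rule inj_onI, rule ccontr)
    fix v w
    assume vw: "v \<in> neighborhood E u" "w \<in> neighborhood E u"
      and eq: "card (left_neighbors E u v) = card (left_neighbors E u w)" and "v \<noteq> w"
    have "\<not> collinear {v, u, w}"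
      using general_position[of v u w] vw \<open>v \<noteq> w\<close> assms(1) neighborhood_subset[of u]
      by (auto simp: neighborhood_def)
    then have "orient u v w \<noteq> 0"
      using collinear_if_orient_zero by blast
    then have "0 < orient u v w \<or> 0 < orient u w v"
      using orient_swap_last[of u w v] by linarith
    with less vw eq show False
      by fastforce
  qed
qed

lemma sum_choose_two_left_neighbors_le:
  assumes "u \<in> V" "convex_vertex E u"
  shows "(\<Sum>v\<in>neighborhood E u. (D - card (left_neighbors E u v)) choose 2) \<le> Suc D choose 3"
proof -
  let ?a = "\<lambda>v. card (left_neighbors E u v)"
  have "(\<Sum>v\<in>neighborhood E u. (D - ?a v) choose 2) = (\<Sum>i\<in>?a ` neighborhood E u. (D - i) choose 2)"
    using sum.reindex[OF inj_on_card_left_neighbors[OF assms], of "\<lambda>i. (D - i) choose 2"] by simp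
  \<comment> \<open>The counts may skip values below \<open>D\<close>, which are added here; values
    from \<open>D\<close> on contribute \<open>0 choose 2 = 0\<close> and are dropped next.\<close>
  also have "\<dots> \<le> (\<Sum>i\<in>?a ` neighborhood E u \<union> {..<D}. (D - i) choose 2)"
    by (rule sum_mono2) (auto simp: finite_neighborhood)
  also have "\<dots> = (\<Sum>i<D. (D - i) choose 2)"
    by (rule sum.mono_neutral_right) (auto simp: finite_neighborhood)
  finally show ?thesis
    by (simp only: sum_choose_two_descending)
qed

lemma disjoint_pairs_lower_bound:
  assumes "locally_convex V E"
  shows "2 * card E * (D choose 2)
           \<le> 2 * card (disjoint_edge_pairs E) + 2 * card V * (Suc D choose 3)"
proof -
  let ?a = "\<lambda>u v. card (left_neighbors E u v)"
  let ?s = "\<Sum>(u, v)\<in>darts E. (D - ?a u v) choose 2"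
  have "?s = (\<Sum>u\<in>V. \<Sum>v\<in>neighborhood E u. (D - ?a u v) choose 2)"
    unfolding darts_Sigma by (rule sum.Sigma[symmetric]) (auto simp: finite_vertices finite_neighborhood)
  also have "\<dots> \<le> card V * (Suc D choose 3)"
    using sum_bounded_above[of V _ "Suc D choose 3"] sum_choose_two_left_neighbors_le assms
    by (simp add: locally_convex_def)
  finally have s: "?s \<le> card V * (Suc D choose 3)" .
  \<comment> \<open>Reversing every dart permutes \<open>darts E\<close>, so both correction terms
    have the same sum.\<close>
  have swap: "(\<Sum>(u, v)\<in>darts E. (D - ?a v u) choose 2) = ?s"
    by (rule sum.reindex_bij_witness[of _ prod.swap prod.swap])
      (auto simp: darts_def neighborhood_sym)
  have "2 * card E * (D choose 2) = (\<Sum>(u, v)\<in>darts E. D choose 2)"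
    by (simp add: card_darts case_prod_unfold)
  also have "\<dots> \<le> (\<Sum>(u, v)\<in>darts E. ?a u v * ?a v u + ((D - ?a u v) choose 2) + ((D - ?a v u) choose 2))"
    by (rule sum_mono) (auto simp: choose_two_product_bound)
  also have "\<dots> = (\<Sum>(u, v)\<in>darts E. ?a u v * ?a v u) + ?s + ?s"
    using swap by (simp add: case_prod_unfold sum.distrib)
  finally show ?thesis
    using sum_left_neighbors_le_disjoint_pairs s by linarith
qed

end

section \<open>From integer \<open>D\<close> to the average degree\<close>

theorem theorem1p2:
  fixes V :: "(real ^ 2) set" and E :: "(real ^ 2) set set"
  assumes "geometric_graph V E"
    and "locally_convex V E"
    and "2 * card E \<ge> card V"
  shows "real (card (disjoint_edge_pairs E))
           \<ge> real (card V) / 2 * (average_degree V E gchoose 3)"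
proof (cases "card V = 0")
  case False
  interpret geometric_graph V E by fact
  define d where "d = average_degree V E"
  define n where "n = real (card V)"
  define D where "D = nat \<lfloor>d\<rfloor>"
  have n: "0 < n"
    using False by (simp add: n_def)
  have nd: "2 * real (card E) = n * d"
    using n by (simp add: n_def d_def average_degree_def)
  \<comment> \<open>The assumption on the number of edges gives \<open>d\<close> at least 1, hence
    \<open>D\<close> at least 1, as the interpolation bound requires.\<close>
  have "n * 1 \<le> n * d"
    using assms(3) nd unfolding n_def by linarith
  then have "1 \<le> d"
    using n by (simp only: mult_le_cancel_left_pos)
  then have "real D = of_int \<lfloor>d\<rfloor>" "1 \<le> \<lfloor>d\<rfloor>"
    by (simp_all add: D_def)
  then have D: "1 \<le> real D" "real D \<le> d" "d \<le> real D + 1"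
    by linarith+
  have "real (2 * card E * (D choose 2))
          \<le> real (2 * card (disjoint_edge_pairs E) + 2 * card V * (Suc D choose 3))"
    using disjoint_pairs_lower_bound[OF assms(2)] of_nat_le_iff by blast
  then have "n * d * (real D gchoose 2)
               \<le> 2 * real (card (disjoint_edge_pairs E)) + 2 * n * ((real D + 1) gchoose 3)"
    using nd binomial_gbinomial[where 'a = real, of "Suc D" 3]
    by (simp add: binomial_gbinomial n_def add.commute)
  moreover have "n * (d gchoose 3) \<le> n * (d * (real D gchoose 2) - 2 * ((real D + 1) gchoose 3))"
    using gbinomial_3_le_interpolation[OF D] n by (intro mult_left_mono) auto
  ultimately have "n * (d gchoose 3) \<le> 2 * real (card (disjoint_edge_pairs E))"
    by (simp add: algebra_simps)
  then show ?thesis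
    by (simp add: n_def d_def)
qed simp

end
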